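(* Let $\beta \in \mathbb{R}$ and let $D_2 \in \mathbb{R}^{N\times N}$ be a second-derivative summation-by-parts (SBP) operator on a grid $x=(x_1,\dots,x_N)^T$ with diagonal mass matrix $M$, boundary vectors $t_L,t_R,d_L,d_R \in \mathbb{R}^N$ and associated symmetric matrix $A_2$ (so $M D_2 = t_R d_R^T - t_L d_L^T - A_2$). Consider the semidiscretization $$ \begin{aligned} \partial_t v &= -\bigl(D_2 - M^{-1} t_R d_R^T + M^{-1} t_L d_L^T\bigr) w - \beta\,(v^2+w^2)\,w,\\ \partial_t w &= \phantom{-}\bigl(D_2 - M^{-1} t_R d_R^T + M^{-1} t_L d_L^T\bigr) v + \beta\,(v^2+w^2)\,v, \end{aligned} $$ for the unknowns $v=v(t)\in\mathbb{R}^N$ and $w=w(t)\in\mathbb{R}^N$. Then this semidiscretization conserves the discrete total mass $$\mathcal{M} = v^T M v + w^T M w$$ and the discrete total energy $$\mathcal{E} = v^T A_2 v + w^T A_2 w - \frac{\beta}{2}\, \mathbf{1}^T M (v^2+w^2)^2,$$ i.e., $\frac{d}{dt}\mathcal{M} = 0$ and $\frac{d}{dt}\mathcal{E}=0$ along solutions.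
   Context: The system is a semidiscretization of the nonlinear Schrödinger equation $\mathrm{i}u_t + u_{xx} + \beta|u|^2u=0$ on $(x_L,x_R)$ with $u=v+\mathrm{i}w$, with periodic or homogeneous Neumann boundary conditions. Notation: products and powers of vectors in $\mathbb{R}^N$ such as $v^2$, $w^2$, $(v^2+w^2)w$, $(v^2+w^2)^2$ are taken componentwise; $\mathbf{1}=(1,\dots,1)^T\in\mathbb{R}^N$. Grid: $x=(x_1,\dots,x_N)^T$ with $x_L = x_1 \le x_2 \le \dots \le x_N$, possibly non-uniform and possibly with repeated nodes; $x_N = x_R$ for non-periodic boundary conditions, while $x_N$ may differ from $x_R$ in the periodic case. Boundary vectors: on a non-periodic domain, $t_L=(1,0,\dots,0)^T$ and $t_R=(0,\dots,0,1)^T$ in $\mathbb{R}^N$. On a periodic domain, the convention $t_L=t_R=d_L=d_R=0$ is used. Definition (second-derivative SBP operator): it is given by a consistent second-derivative operator $D_2\in\mathbb{R}^{N\times N}$ (a matrix consistently approximating $\partial_{xx}$ on grid functions) and a symmetric positive definite mass (or norm) matrix $M\in\mathbb{R}^{N\times N}$ such that $$M D_2 = t_R d_R^T - t_L d_L^T - A_2,\qquad A_2 \text{ symmetric and positive semidefinite},$$ where $d_L,d_R\in\mathbb{R}^N$ yield consistent first-derivative approximations at the left and right boundaries (in the non-periodic case). The operator is called diagonal-norm if $M$ is diagonal. *)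

theory Defs
  imports "HOL-Analysis.Analysis" "HOL-Computational_Algebra.Polynomial"
begin

text \<open>
  The grid has \<open>N = CARD('n)\<close> nodes, indexed by a finite linear order \<open>'n\<close>; its least and greatest
  elements play the roles of the indices \<open>1\<close> and \<open>N\<close>. On \<open>real^'n\<close> the library operations
  \<open>*\<close>, \<open>^\<close> and \<open>1\<close> are componentwise; the matrix products are \<open>**\<close> and \<open>*v\<close>.
\<close>

definition first_index :: "'n::{finite,linorder}" where
  "first_index = Min UNIV"

definition last_index :: "'n::{finite,linorder}" where
  "last_index = Max UNIV"

datatype boundary_kind = Periodic | Nonperiodic

definition symmetric_matrix :: "real^'n^'n \<Rightarrow> bool" where
  "symmetric_matrix A \<longleftrightarrow> transpose A = A"

definition positive_definite_matrix :: "real^'n^'n \<Rightarrow> bool" where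
  "positive_definite_matrix A \<longleftrightarrow> (\<forall>z. z \<noteq> 0 \<longrightarrow> 0 < z \<bullet> (A *v z))"

definition positive_semidefinite_matrix :: "real^'n^'n \<Rightarrow> bool" where
  "positive_semidefinite_matrix A \<longleftrightarrow> (\<forall>z. 0 \<le> z \<bullet> (A *v z))"

definition diagonal_matrix :: "real^'n^'n \<Rightarrow> bool" where
  "diagonal_matrix A \<longleftrightarrow> (\<forall>i j. i \<noteq> j \<longrightarrow> A $ i $ j = 0)"

definition outer_product :: "real^'n \<Rightarrow> real^'n \<Rightarrow> real^'n^'n" where
  "outer_product a b = (\<chi> i j. a $ i * b $ j)"

definition grid_function :: "real^'n \<Rightarrow> (real \<Rightarrow> real) \<Rightarrow> real^'n" where
  "grid_function x f = (\<chi> i. f (x $ i))"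

text \<open>
  Consistency on a fixed grid is exactness on the polynomials of degree at most the order of the
  derivative. A periodic operator is in general not exact on polynomials evaluated at the nodes in
  one period only, since polynomials are not periodic. There, the entry \<open>D $ i $ j\<close> collects the
  weights \<open>C m $ i $ j\<close> that the stencil at node \<open>i\<close> gives to the periodic images
  \<open>x $ j + m * L\<close> of node \<open>j\<close>, and exactness is required of this stencil.
\<close>

definition consistent_second_derivative :: "real^'n \<Rightarrow> real^'n^'n \<Rightarrow> bool" where
  "consistent_second_derivative x D \<longleftrightarrow>
    (\<forall>p. degree p \<le> 2 \<longrightarrow>
      D *v grid_function x (poly p) = grid_function x (poly (pderiv (pderiv p))))"

definition consistent_periodic_second_derivative ::
    "real \<Rightarrow> real^'n \<Rightarrow> real^'n^'n \<Rightarrow> bool" where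
  "consistent_periodic_second_derivative L x D \<longleftrightarrow>
    (\<exists>(S::int set) (C::int \<Rightarrow> real^'n^'n).
      finite S \<and> D = (\<Sum>m\<in>S. C m) \<and>
      (\<forall>p. degree p \<le> 2 \<longrightarrow>
        (\<Sum>m\<in>S. C m *v grid_function x (\<lambda>y. poly p (y + of_int m * L))) =
        grid_function x (poly (pderiv (pderiv p)))))"

definition consistent_first_derivative_at :: "real \<Rightarrow> real^'n \<Rightarrow> real^'n \<Rightarrow> bool" where
  "consistent_first_derivative_at a x d \<longleftrightarrow>
    (\<forall>p. degree p \<le> 1 \<longrightarrow> d \<bullet> grid_function x (poly p) = poly (pderiv p) a)"

locale second_derivative_sbp =
  fixes bc :: boundary_kind
    and x\<^sub>L x\<^sub>R :: real
    and x :: "real^'n::{finite,linorder}"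
    and D\<^sub>2 M A\<^sub>2 :: "((real, 'n) vec, 'n) vec"
    and t\<^sub>L t\<^sub>R d\<^sub>L d\<^sub>R :: "(real, 'n) vec"
  assumes domain: "x\<^sub>L < x\<^sub>R"
    and grid_mono: "i \<le> j \<Longrightarrow> x $ i \<le> x $ j"
    and grid_left: "x $ first_index = x\<^sub>L"
    and grid_right: "x $ last_index \<le> x\<^sub>R"
    and grid_right_nonperiodic: "bc = Nonperiodic \<Longrightarrow> x $ last_index = x\<^sub>R"
    and boundary_nonperiodic: "bc = Nonperiodic \<Longrightarrow>
      t\<^sub>L = axis first_index 1 \<and> t\<^sub>R = axis last_index 1"
    and boundary_periodic: "bc = Periodic \<Longrightarrow> t\<^sub>L = 0 \<and> t\<^sub>R = 0 \<and> d\<^sub>L = 0 \<and> d\<^sub>R = 0"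
    and D2_consistent: "bc = Nonperiodic \<Longrightarrow> consistent_second_derivative x D\<^sub>2"
    and D2_consistent_periodic: "bc = Periodic \<Longrightarrow>
      consistent_periodic_second_derivative (x\<^sub>R - x\<^sub>L) x D\<^sub>2"
    and d_consistent: "bc = Nonperiodic \<Longrightarrow>
      consistent_first_derivative_at x\<^sub>L x d\<^sub>L \<and> consistent_first_derivative_at x\<^sub>R x d\<^sub>R"
    and M_symmetric: "symmetric_matrix M"
    and M_positive_definite: "positive_definite_matrix M"
    and A2_symmetric: "symmetric_matrix A\<^sub>2"
    and A2_positive_semidefinite: "positive_semidefinite_matrix A\<^sub>2"
    and sbp: "M ** D\<^sub>2 = outer_product t\<^sub>R d\<^sub>R - outer_product t\<^sub>L d\<^sub>L - A\<^sub>2"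

definition nls_operator ::
    "real^'n^'n \<Rightarrow> real^'n^'n \<Rightarrow> real^'n \<Rightarrow> real^'n \<Rightarrow> real^'n \<Rightarrow> real^'n \<Rightarrow> real^'n^'n" where
  "nls_operator D\<^sub>2 M t\<^sub>L t\<^sub>R d\<^sub>L d\<^sub>R =
    D\<^sub>2 - matrix_inv M ** outer_product t\<^sub>R d\<^sub>R + matrix_inv M ** outer_product t\<^sub>L d\<^sub>L"

text \<open>Solutions on a set \<open>T\<close> of times, with one-sided derivatives at end points belonging to \<open>T\<close>.\<close>

definition nls_semidiscrete_solution ::
    "real \<Rightarrow> real^'n^'n \<Rightarrow> real^'n^'n \<Rightarrow> real^'n \<Rightarrow> real^'n \<Rightarrow> real^'n \<Rightarrow> real^'n \<Rightarrow>
      real set \<Rightarrow> (real \<Rightarrow> real^'n) \<Rightarrow> (real \<Rightarrow> real^'n) \<Rightarrow> bool" where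
  "nls_semidiscrete_solution \<beta> D\<^sub>2 M t\<^sub>L t\<^sub>R d\<^sub>L d\<^sub>R T v w \<longleftrightarrow>
    (\<forall>t\<in>T.
      (v has_vector_derivative
        - (nls_operator D\<^sub>2 M t\<^sub>L t\<^sub>R d\<^sub>L d\<^sub>R *v w t)
        - \<beta> *\<^sub>R (((v t)^2 + (w t)^2) * w t)) (at t within T) \<and>
      (w has_vector_derivative
        nls_operator D\<^sub>2 M t\<^sub>L t\<^sub>R d\<^sub>L d\<^sub>R *v v t
        + \<beta> *\<^sub>R (((v t)^2 + (w t)^2) * v t)) (at t within T))"

definition total_mass :: "real^'n^'n \<Rightarrow> real^'n \<Rightarrow> real^'n \<Rightarrow> real" where
  "total_mass M v w = v \<bullet> (M *v v) + w \<bullet> (M *v w)"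

definition total_energy ::
    "real \<Rightarrow> real^'n^'n \<Rightarrow> real^'n^'n \<Rightarrow> real^'n \<Rightarrow> real^'n \<Rightarrow> real" where
  "total_energy \<beta> M A\<^sub>2 v w =
    v \<bullet> (A\<^sub>2 *v v) + w \<bullet> (A\<^sub>2 *v w) - \<beta> / 2 * (1 \<bullet> (M *v ((v^2 + w^2)^2)))"

end

theory Submission
  imports Defs
begin

text \<open>
  Let \<open>P\<close> denote the operator on the right-hand side and \<open>q = v^2 + w^2\<close>. Multiplied by \<open>M\<close>, the
  boundary corrections in \<open>P\<close> cancel exactly the boundary terms of the summation-by-parts
  identity, so \<open>M P = - A\<^sub>2\<close> (\<open>mass_times_nls_operator\<close>) and the system becomes Hamiltonian:
  \<open>M v' = H\<^sub>w\<close> and \<open>M w' = - H\<^sub>v\<close>, where \<open>H\<^sub>v = A\<^sub>2 v - \<beta> M (q v)\<close> and \<open>H\<^sub>w = A\<^sub>2 w - \<beta> M (q w)\<close>.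

  For diagonal \<open>M\<close>, the vectors \<open>H\<^sub>v\<close> and \<open>H\<^sub>w\<close> are half the gradients of the energy, because
  componentwise factors move freely across the \<open>M\<close>-inner product (\<open>diagonal_matrix_inner_times\<close>).
  The derivative of the energy is therefore \<open>2 (v' \<bullet> H\<^sub>v + w' \<bullet> H\<^sub>w) = 2 (- v' \<bullet> M w' + w' \<bullet> M v') = 0\<close>
  by symmetry of \<open>M\<close>. The derivative of the mass is \<open>2 (v \<bullet> H\<^sub>w - w \<bullet> H\<^sub>v)\<close>, in which the
  contributions of \<open>A\<^sub>2\<close> cancel by symmetry and those of the nonlinearity because both equal the
  same sum over the nodes; this is the invariance of the energy under rotations of \<open>(v, w)\<close>.
\<close>

lemma symmetric_matrix_inner:
  assumes "symmetric_matrix S"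
  shows "a \<bullet> (S *v b) = b \<bullet> (S *v a)"
  using assms dot_lmul_matrix[of a S b] transpose_matrix_vector[of S a]
  by (simp add: symmetric_matrix_def inner_commute)

lemma positive_definite_imp_invertible:
  assumes "positive_definite_matrix S"
  shows "invertible S"
proof -
  have "z = 0" if "S *v z = 0" for z
    using assms that by (force simp: positive_definite_matrix_def)
  then show ?thesis
    by (simp add: invertible_left_inverse matrix_left_invertible_ker)
qed

lemma diagonal_matrix_mult_vec_nth:
  assumes "diagonal_matrix S"
  shows "(S *v a) $ i = S $ i $ i * a $ i"
proof -
  have "(S *v a) $ i = (\<Sum>j\<in>UNIV. if j = i then S $ i $ i * a $ i else 0)"
    unfolding matrix_vector_mult_def vec_lambda_beta
    using assms by (intro sum.cong) (auto simp: diagonal_matrix_def)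
  then show ?thesis
    by simp
qed

text \<open>
  Componentwise multiplication by \<open>b\<close> is itself given by a diagonal matrix, and diagonal matrices
  commute.
\<close>

lemma diagonal_matrix_inner_times:
  assumes "diagonal_matrix S"
  shows "a \<bullet> (S *v (b * c)) = (a * b) \<bullet> (S *v c)"
  by (simp add: inner_vec_def diagonal_matrix_mult_vec_nth[OF assms] mult.assoc mult.left_commute)

lemma bounded_bilinear_vec_times:
  "bounded_bilinear ((*) :: real^'n \<Rightarrow> real^'n \<Rightarrow> real^'n)"
  by (subst bilinear_conv_bounded_bilinear[symmetric])
    (simp add: bilinear_def linear_iff vec_eq_iff algebra_simps)

lemma has_vector_derivative_vec_square:
  fixes f :: "real \<Rightarrow> real^'n"
  assumes "(f has_vector_derivative f') (at t within T)"
  shows "((\<lambda>s. (f s)^2) has_vector_derivative 2 *\<^sub>R (f t * f')) (at t within T)"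
  using bounded_bilinear.has_vector_derivative[OF bounded_bilinear_vec_times assms assms]
  by (simp add: power2_eq_square scaleR_2 mult.commute)

lemma has_real_derivative_quadratic_form:
  assumes "symmetric_matrix S"
    and "(f has_vector_derivative f') (at t within T)"
  shows "((\<lambda>s. f s \<bullet> (S *v f s)) has_real_derivative 2 * (f' \<bullet> (S *v f t))) (at t within T)"
proof -
  have "((\<lambda>s. S *v f s) has_vector_derivative S *v f') (at t within T)"
    by (rule bounded_linear.has_vector_derivative[OF _ assms(2)])
      (simp add: matrix_vector_mul_bounded_linear)
  from bounded_bilinear.has_vector_derivative[OF bounded_bilinear_inner assms(2) this]
  show ?thesis
    using symmetric_matrix_inner[OF assms(1), of "f t" f']
    by (simp add: has_real_derivative_iff_has_vector_derivative)
qed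

lemma mass_times_nls_operator:
  fixes M :: "real^'n^'n"
  assumes "invertible M"
    and "M ** D\<^sub>2 = outer_product t\<^sub>R d\<^sub>R - outer_product t\<^sub>L d\<^sub>L - A\<^sub>2"
  shows "M *v (nls_operator D\<^sub>2 M t\<^sub>L t\<^sub>R d\<^sub>L d\<^sub>R *v a) = - (A\<^sub>2 *v a)"
proof -
  have "M ** matrix_inv M = mat 1"
    using assms(1) unfolding invertible_def matrix_inv_def by (rule someI2_ex) simp
  then have "M ** (matrix_inv M ** B) = B" for B :: "real^'n^'n"
    by (simp add: matrix_mul_assoc)
  then have "M *v (matrix_inv M ** B *v a) = B *v a" for B :: "real^'n^'n"
    by (simp add: matrix_vector_mul_assoc)
  moreover have "M *v (D\<^sub>2 *v a) = outer_product t\<^sub>R d\<^sub>R *v a - outer_product t\<^sub>L d\<^sub>L *v a - A\<^sub>2 *v a"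
    by (simp add: matrix_vector_mul_assoc assms(2) matrix_vector_mult_diff_rdistrib)
  ultimately show ?thesis
    by (simp add: nls_operator_def matrix_vector_mult_diff_rdistrib matrix_vector_mult_add_rdistrib
        matrix_vector_mult_diff_distrib matrix_vector_right_distrib)
qed

text \<open>
  For diagonal \<open>M\<close> the quartic part of the energy is the quadratic form of \<open>M\<close> at \<open>v^2 + w^2\<close>, so
  that the whole energy is a combination of quadratic forms.
\<close>

lemma has_real_derivative_total_energy:
  assumes "symmetric_matrix M" and "diagonal_matrix M" and "symmetric_matrix A"
    and v: "(v has_vector_derivative v') (at t within T)"
    and w: "(w has_vector_derivative w') (at t within T)"
  defines "q \<equiv> (v t)^2 + (w t)^2"
  shows "((\<lambda>s. total_energy \<beta> M A (v s) (w s)) has_real_derivative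
      2 * (v' \<bullet> (A *v v t - \<beta> *\<^sub>R (M *v (q * v t))) + w' \<bullet> (A *v w t - \<beta> *\<^sub>R (M *v (q * w t)))))
    (at t within T)"
proof -
  note quadratic = has_real_derivative_quadratic_form
  define g where "g s = (v s)^2 + (w s)^2" for s
  have "(g has_vector_derivative 2 *\<^sub>R (v t * v') + 2 *\<^sub>R (w t * w')) (at t within T)"
    unfolding g_def
    by (intro has_vector_derivative_add has_vector_derivative_vec_square v w)
  note g = quadratic[OF assms(1) this]
  have "(\<lambda>s. total_energy \<beta> M A (v s) (w s)) = (\<lambda>s. v s \<bullet> (A *v v s) + w s \<bullet> (A *v w s) - \<beta> / 2 * (g s \<bullet> (M *v g s)))"
    by (simp add: total_energy_def g_def power2_eq_square[of "_ + _"]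
        diagonal_matrix_inner_times[OF assms(2), of 1])
  moreover have "(v t * v') \<bullet> (M *v g t) = v' \<bullet> (M *v (q * v t))"
    and "(w t * w') \<bullet> (M *v g t) = w' \<bullet> (M *v (q * w t))"
    using diagonal_matrix_inner_times[OF assms(2), of v' "v t" q]
      diagonal_matrix_inner_times[OF assms(2), of w' "w t" q]
    by (simp_all add: q_def g_def mult.commute)
  moreover have "((\<lambda>s. v s \<bullet> (A *v v s) + w s \<bullet> (A *v w s) - \<beta> / 2 * (g s \<bullet> (M *v g s)))
      has_real_derivative
        2 * (v' \<bullet> (A *v v t)) + 2 * (w' \<bullet> (A *v w t))
        - \<beta> / 2 * (2 * ((2 *\<^sub>R (v t * v') + 2 *\<^sub>R (w t * w')) \<bullet> (M *v g t)))) (at t within T)"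
    by (intro DERIV_add DERIV_diff DERIV_cmult quadratic[OF assms(3)] v w g)
  ultimately show ?thesis
    by (simp add: inner_add_left inner_diff_right algebra_simps)
qed

theorem theorem2p4:
  fixes \<beta> x\<^sub>L x\<^sub>R :: real
    and bc :: boundary_kind
    and x t\<^sub>L t\<^sub>R d\<^sub>L d\<^sub>R :: "real^'n::{finite,linorder}"
    and D\<^sub>2 M A\<^sub>2 :: "((real, 'n) vec, 'n) vec"
    and T :: "real set"
    and v w :: "real \<Rightarrow> (real, 'n) vec"
  assumes "second_derivative_sbp bc x\<^sub>L x\<^sub>R x D\<^sub>2 M A\<^sub>2 t\<^sub>L t\<^sub>R d\<^sub>L d\<^sub>R"
    and "diagonal_matrix M"
    and "is_interval T"
    and "nls_semidiscrete_solution \<beta> D\<^sub>2 M t\<^sub>L t\<^sub>R d\<^sub>L d\<^sub>R T v w"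
  shows "\<forall>t\<in>T.
      ((\<lambda>s. total_mass M (v s) (w s)) has_real_derivative 0) (at t within T) \<and>
      ((\<lambda>s. total_energy \<beta> M A\<^sub>2 (v s) (w s)) has_real_derivative 0) (at t within T)"
proof
  fix t
  assume "t \<in> T"
  interpret second_derivative_sbp bc x\<^sub>L x\<^sub>R x D\<^sub>2 M A\<^sub>2 t\<^sub>L t\<^sub>R d\<^sub>L d\<^sub>R
    by (fact assms(1))
  let ?P = "nls_operator D\<^sub>2 M t\<^sub>L t\<^sub>R d\<^sub>L d\<^sub>R"
  define q where "q = (v t)^2 + (w t)^2"
  define v' where "v' = - (?P *v w t) - \<beta> *\<^sub>R (q * w t)"
  define w' where "w' = ?P *v v t + \<beta> *\<^sub>R (q * v t)"
  have v: "(v has_vector_derivative v') (at t within T)"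
    and w: "(w has_vector_derivative w') (at t within T)"
    using assms(4) \<open>t \<in> T\<close> by (auto simp: nls_semidiscrete_solution_def v'_def w'_def q_def)

  define H\<^sub>v where "H\<^sub>v = A\<^sub>2 *v v t - \<beta> *\<^sub>R (M *v (q * v t))"
  define H\<^sub>w where "H\<^sub>w = A\<^sub>2 *v w t - \<beta> *\<^sub>R (M *v (q * w t))"
  note MP = mass_times_nls_operator[OF positive_definite_imp_invertible[OF M_positive_definite] sbp]
  have Mv': "M *v v' = H\<^sub>w"
    using MP[of "w t"]
    by (simp add: v'_def H\<^sub>w_def matrix_vector_mult_diff_distrib linear_neg[OF matrix_vector_mul_linear]
        matrix_vector_mult_scaleR)
  have Mw': "M *v w' = - H\<^sub>v"
    using MP[of "v t"]
    by (simp add: w'_def H\<^sub>v_def matrix_vector_right_distrib matrix_vector_mult_scaleR)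

  have "((\<lambda>s. total_mass M (v s) (w s)) has_real_derivative
      2 * (v' \<bullet> (M *v v t)) + 2 * (w' \<bullet> (M *v w t))) (at t within T)"
    unfolding total_mass_def
    by (intro DERIV_add has_real_derivative_quadratic_form M_symmetric v w)
  moreover have "v' \<bullet> (M *v v t) = v t \<bullet> H\<^sub>w" and "w' \<bullet> (M *v w t) = - (w t \<bullet> H\<^sub>v)"
    using symmetric_matrix_inner[OF M_symmetric, of v' "v t"]
      symmetric_matrix_inner[OF M_symmetric, of w' "w t"]
    by (simp_all add: Mv' Mw')
  moreover have "v t \<bullet> H\<^sub>w = w t \<bullet> H\<^sub>v"
  proof -
    have "v t \<bullet> (M *v (q * w t)) = w t \<bullet> (M *v (q * v t))"
      using diagonal_matrix_inner_times[OF assms(2), of "v t" "w t" q]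
        diagonal_matrix_inner_times[OF assms(2), of "w t" "v t" q]
      by (simp add: mult.commute)
    then show ?thesis
      using symmetric_matrix_inner[OF A2_symmetric, of "v t" "w t"]
      by (simp add: H\<^sub>v_def H\<^sub>w_def inner_diff_right)
  qed
  ultimately have mass: "((\<lambda>s. total_mass M (v s) (w s)) has_real_derivative 0) (at t within T)"
    by simp

  have "((\<lambda>s. total_energy \<beta> M A\<^sub>2 (v s) (w s)) has_real_derivative
      2 * (v' \<bullet> H\<^sub>v + w' \<bullet> H\<^sub>w)) (at t within T)"
    using has_real_derivative_total_energy[OF M_symmetric assms(2) A2_symmetric v w]
    by (simp add: H\<^sub>v_def H\<^sub>w_def q_def)
  moreover have "v' \<bullet> H\<^sub>v + w' \<bullet> H\<^sub>w = 0"
    using symmetric_matrix_inner[OF M_symmetric, of v' w'] by (simp add: Mv' Mw')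
  ultimately have "((\<lambda>s. total_energy \<beta> M A\<^sub>2 (v s) (w s)) has_real_derivative 0) (at t within T)"
    by simp
  with mass show "((\<lambda>s. total_mass M (v s) (w s)) has_real_derivative 0) (at t within T) \<and>
      ((\<lambda>s. total_energy \<beta> M A\<^sub>2 (v s) (w s)) has_real_derivative 0) (at t within T)"
    by (rule conjI)
qed

end
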